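(* $$\int_0^1 \ln(-\ln x)\,\frac{1}{(1+x)^2}\,dx = \frac12\left(\ln\frac{\pi}{2}-\gamma\right).$$
   Context: $\gamma = \lim_{n\to\infty}\left(\sum_{k=1}^n \frac1k - \ln n\right)$ is the Euler-Mascheroni constant. *)

theory Defs
  imports "HOL-Analysis.Analysis"
begin

end

theory Submission
  imports Defs
begin

text \<open>Substitute \<open>x = y\<close> with \<open>y = exp (- t)\<close>. Since \<open>\<integral> ln t * n * y ^ n dt = - \<gamma> - ln n\<close>
  over \<open>t > 0\<close>, integrating averaged partial sums of the alternating expansion of
  \<open>y / (1 + y)\<^sup>2\<close> against \<open>ln t\<close> gives exactly \<open>(ln W - \<gamma>) / 2\<close> with \<open>W\<close> a partial product of Wallis'
  formula for \<open>\<pi> / 2\<close>. Dominated convergence yields the claim.\<close>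

section \<open>Integrals of \<open>ln t\<close> against exponentials on the half-line\<close>

lemma has_integral_Ioi_iff_Ici:
  fixes f :: "real \<Rightarrow> 'a::banach"
  shows "(f has_integral I) {a<..} \<longleftrightarrow> (f has_integral I) {a..}"
proof (rule has_integral_spike_set_eq)
  show "negligible {x \<in> {a<..} - {a..}. f x \<noteq> 0}"
    by (rule negligible_subset[of "{}"]) auto
  show "negligible {x \<in> {a..} - {a<..}. f x \<noteq> 0}"
    by (rule negligible_subset[of "{a}"]) auto
qed

text \<open>Convexity of \<open>exp\<close>: secant slopes from the origin increase. With
  \<open>u = ln t\<close> these are the difference quotients of \<open>h \<mapsto> t powr h\<close>
  at 0.\<close>

lemma exp_secant_slope_mono:
  fixes u h k :: real
  assumes "0 < h" "h \<le> k"
  shows "(exp (h * u) - 1) / h \<le> (exp (k * u) - 1) / k"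
proof -
  define l where "l = h / k"
  have l: "0 \<le> l" "l \<le> 1" "l * k = h" "0 < k"
    using assms by (auto simp: l_def field_simps)
  have "exp ((1 - l) *\<^sub>R 0 + l *\<^sub>R (k * u)) \<le> (1 - l) * exp 0 + l * exp (k * u)"
    by (rule convex_onD[OF exp_convex]) (use l in auto)
  also have "(1 - l) *\<^sub>R 0 + l *\<^sub>R (k * u) = h * u"
    using l by (simp flip: mult.assoc)
  finally have "exp (h * u) - 1 \<le> l * (exp (k * u) - 1)"
    by (simp add: algebra_simps)
  then show ?thesis
    using assms unfolding l_def by (simp add: field_simps)
qed

text \<open>Differentiation of Euler's integral at \<open>1\<close>: the difference quotients of \<open>h \<mapsto> t powr h\<close>
  at \<open>0\<close> decrease to \<open>ln t\<close> as \<open>h\<close> decreases to \<open>0\<close>, so monotone convergence applies.\<close>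

lemma ln_times_exp_minus_has_integral:
  "((\<lambda>t::real. ln t * exp (- t)) has_integral - euler_mascheroni) {0<..}"
proof -
  define h :: "nat \<Rightarrow> real" where "h = (\<lambda>k. 1 / real (Suc k))"
  have h_pos: "0 < h k" and h_le: "h (Suc k) \<le> h k" for k
    by (simp_all add: h_def field_simps)
  have h_lim: "filterlim h (at 0) sequentially"
    unfolding filterlim_at h_def
    using LIMSEQ_Suc[OF lim_1_over_n] by (auto simp del: of_nat_Suc)
  define f where "f = (\<lambda>k t::real. (t powr h k - 1) / h k * exp (- t))"
  have f_int: "(f k has_integral (Gamma (1 + h k) - Gamma 1) / h k) {0<..}" for k
  proof -
    have "((\<lambda>t::real. (t powr (1 + h k - 1) / exp t - t powr (1 - 1) / exp t) / h k)
            has_integral (Gamma (1 + h k) - Gamma 1) / h k) {0<..}"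
      unfolding has_integral_Ioi_iff_Ici using h_pos[of k]
      by (intro has_integral_divide has_integral_diff Gamma_integral_real) auto
    then show ?thesis
      by (rule has_integral_eq[rotated]) (simp add: f_def exp_minus field_simps)
  qed
  have Gamma_lim: "(\<lambda>k. (Gamma (1 + h k) - Gamma 1) / h k) \<longlonglongrightarrow> - euler_mascheroni"
  proof -
    \<comment> \<open>The value comes from \<open>Digamma 1 = - euler_mascheroni\<close> and
      \<open>Gamma 1 = 1\<close>.\<close>
    have "(Gamma has_field_derivative Gamma 1 * Digamma 1) (at (1::real))"
      by (rule has_field_derivative_Gamma) simp
    then have "((\<lambda>h::real. (Gamma (1 + h) - Gamma 1) / h) \<longlongrightarrow> - euler_mascheroni) (at 0)"
      by (simp add: DERIV_def)
    from filterlim_compose[OF this h_lim] show ?thesis .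
  qed
  have integral_f: "integral {0<..} (f k) = (Gamma (1 + h k) - Gamma 1) / h k" for k
    using f_int by (rule integral_unique)
  have "(\<lambda>t::real. ln t * exp (- t)) integrable_on {0<..} \<and>
        (\<lambda>k. integral {0<..} (f k)) \<longlonglongrightarrow> integral {0<..} (\<lambda>t::real. ln t * exp (- t))"
  proof (rule monotone_convergence_decreasing)
    show "f k integrable_on {0<..}" for k
      using f_int by blast
    show "f (Suc k) t \<le> f k t" if "t \<in> {0<..}" for k t
      unfolding f_def
      by (intro mult_right_mono) (use exp_secant_slope_mono[OF h_pos h_le, of k "ln t"] that in
        \<open>auto simp: powr_def\<close>)
    show "(\<lambda>k. f k t) \<longlonglongrightarrow> ln t * exp (- t)" if "t \<in> {0<..}" for t
    proof -
      have "((\<lambda>h. exp (h * ln t)) has_field_derivative ln t) (at 0)"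
        by (auto intro!: derivative_eq_intros)
      then have "((\<lambda>h. (t powr h - 1) / h) \<longlongrightarrow> ln t) (at 0)"
        using that by (simp add: DERIV_def powr_def)
      from filterlim_compose[OF this h_lim] show ?thesis
        unfolding f_def by (intro tendsto_mult_right) 
    qed
    show "bounded (range (\<lambda>k. integral {0<..} (f k)))"
      unfolding integral_f using Gamma_lim by (rule convergent_imp_bounded)
  qed
  with Gamma_lim show ?thesis
    unfolding integral_f using LIMSEQ_unique has_integral_integral by metis
qed

text \<open>For an integrable function, an absolutely integrable upper bound suffices. Here
  \<open>ln t \<le> t\<close> gives the integrand of \<open>Gamma 2\<close>, so the singularity at 0
  needs no estimate.\<close>

lemma ln_times_exp_minus_absolutely_integrable:
  "(\<lambda>t::real. ln t * exp (- t)) absolutely_integrable_on {0<..}"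
proof (rule absolutely_integrable_absolutely_integrable_ubound)
  show "(\<lambda>t::real. ln t * exp (- t)) integrable_on {0<..}"
    using ln_times_exp_minus_has_integral by blast
  have "((\<lambda>t::real. t powr (2 - 1) / exp t) has_integral Gamma 2) {0<..}"
    unfolding has_integral_Ioi_iff_Ici by (rule Gamma_integral_real) simp
  then have "(\<lambda>t::real. t powr (2 - 1) / exp t) integrable_on {0<..}"
    by blast
  then show "(\<lambda>t::real. t powr (2 - 1) / exp t) absolutely_integrable_on {0<..}"
    by (rule nonnegative_absolutely_integrable_1) auto
  show "ln t * exp (- t) \<le> t powr (2 - 1) / exp t" if "t \<in> {0<..}" for t :: real
    using that ln_le_minus_one[of t] by (simp add: exp_minus field_simps)
qed

text \<open>Replacing \<open>t\<close> by \<open>c * t\<close> in the case \<open>c = 1\<close>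
  turns \<open>ln t\<close> into \<open>ln t + ln c\<close>; the constant part integrates to
  \<open>ln c\<close> and is subtracted.\<close>

lemma ln_times_exp_minus_scaled_has_integral:
  fixes c :: real
  assumes "0 < c"
  shows "((\<lambda>t. ln t * (c * exp (- c * t))) has_integral - euler_mascheroni - ln c) {0<..}"
proof -
  have img: "(\<lambda>t. c * t) ` {0<..} = {0<..}"
    using assms by (auto simp: image_def intro!: bexI[of _ "_ / c"])
  have "(\<lambda>t. \<bar>c\<bar> * (ln (c * t) * exp (- (c * t)))) absolutely_integrable_on {0<..} \<and>
        integral {0<..} (\<lambda>t. \<bar>c\<bar> * (ln (c * t) * exp (- (c * t)))) = - euler_mascheroni"
    using has_absolute_integral_change_of_variables_1'[of "{0<..}" "\<lambda>t. c * t" "\<lambda>_. c"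
        "\<lambda>t. ln t * exp (- t)" "- euler_mascheroni"] assms
      ln_times_exp_minus_absolutely_integrable integral_unique[OF ln_times_exp_minus_has_integral]
    by (auto simp: img inj_on_def intro!: derivative_eq_intros)
  then have "((\<lambda>t. \<bar>c\<bar> * (ln (c * t) * exp (- (c * t)))) has_integral - euler_mascheroni) {0<..}"
    by (simp add: has_integral_iff set_lebesgue_integral_eq_integral(1))
  moreover have "((\<lambda>t. (c * ln c) * exp (- c * t)) has_integral (c * ln c) * (exp (- c * 0) / c)) {0<..}"
    unfolding has_integral_Ioi_iff_Ici
    by (intro has_integral_mult_right has_integral_exp_minus_to_infinity assms)
  ultimately have "((\<lambda>t. \<bar>c\<bar> * (ln (c * t) * exp (- (c * t))) - (c * ln c) * exp (- c * t))
      has_integral - euler_mascheroni - (c * ln c) * (exp (- c * 0) / c)) {0<..}"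
    by (rule has_integral_diff)
  then have "((\<lambda>t. \<bar>c\<bar> * (ln (c * t) * exp (- (c * t))) - (c * ln c) * exp (- c * t))
      has_integral - euler_mascheroni - ln c) {0<..}"
    using assms by simp
  then show ?thesis
    by (rule has_integral_eq[rotated]) (use assms in \<open>simp add: ln_mult algebra_simps\<close>)
qed

lemma ln_times_exp_minus_power_has_integral:
  assumes "0 < n"
  shows "((\<lambda>t::real. ln t * (real n * exp (- t) ^ n)) has_integral - euler_mascheroni - ln (real n)) {0<..}"
  using ln_times_exp_minus_scaled_has_integral[of "real n"] assms
  by (simp flip: exp_of_nat_mult)

section \<open>Averaged partial sums of the alternating series\<close>

text \<open>The mean of the partial sums of order \<open>2 M\<close> and \<open>2 M + 1\<close> of the series
  \<open>y / (1 + y)\<^sup>2 = (\<Sum>n\<ge>1. (-1) ^ (n - 1) * n * y ^ n)\<close>. Unlike the partial sums themselves, these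
  means are bounded by a constant multiple of \<open>y\<close>, uniformly in \<open>M\<close>.\<close>

definition alternating_mean :: "nat \<Rightarrow> real \<Rightarrow> real" where
  "alternating_mean M y = (y + (\<Sum>m=1..M. real (2*m-1) * y ^ (2*m-1) - 2 * (real (2*m) * y ^ (2*m))
      + real (2*m+1) * y ^ (2*m+1))) / 2"

text \<open>Multiplying by \<open>(1 + y)\<^sup>2\<close> makes the sum collapse to a few boundary
  terms, which induction on \<open>M\<close> verifies.\<close>

lemma alternating_mean_closed_form:
  assumes "0 \<le> y"
  shows "alternating_mean M y = (2 * y - real (2*M+1) * y ^ (2*M+1) * (1 - y\<^sup>2) + 2 * y ^ (2*M+2))
    / (2 * (1 + y)\<^sup>2)"
proof -
  have "(1 + y)\<^sup>2 * (2 * alternating_mean M y)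
      = 2 * y - real (2*M+1) * y ^ (2*M+1) * (1 - y\<^sup>2) + 2 * y ^ (2*M+2)"
  proof (induction M)
    case 0
    show ?case by (simp add: alternating_mean_def power2_eq_square algebra_simps)
  next
    case (Suc M)
    have "2 * alternating_mean (Suc M) y = 2 * alternating_mean M y + (real (2*M+1) * y ^ (2*M+1)
        - 2 * (real (2*M+2) * y ^ (2*M+2)) + real (2*M+3) * y ^ (2*M+3))"
    proof -
      have split: "(\<Sum>m=1..Suc M. c m) = (\<Sum>m=1..M. c m) + c (Suc M)" for c :: "nat \<Rightarrow> real"
        by simp
      \<comment> \<open>Removes the truncated subtraction, so that the new summand is in the form
        the algebra needs.\<close>
      have idx: "2 * Suc M = 2*M+2" "2*M+2 - 1 = 2*M+1" "2*M+2 + 1 = 2*M+3"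
        by simp_all
      have half: "2 * ((y + (S + E)) / 2) = 2 * ((y + S) / 2) + E" for S E :: real
        by simp
      show ?thesis
        unfolding alternating_mean_def split idx by (rule half)
    qed
    then have "(1 + y)\<^sup>2 * (2 * alternating_mean (Suc M) y)
        = 2 * y - real (2*M+1) * y ^ (2*M+1) * (1 - y\<^sup>2) + 2 * y ^ (2*M+2)
        + (1 + y)\<^sup>2 * (real (2*M+1) * y ^ (2*M+1)
        - 2 * (real (2*M+2) * y ^ (2*M+2)) + real (2*M+3) * y ^ (2*M+3))"
      using Suc.IH by (simp only: distrib_left)
    then show ?case
      by (simp add: power2_eq_square power_add algebra_simps eval_nat_numeral)
  qed
  moreover have "2 * (1 + y)\<^sup>2 \<noteq> 0"
    using assms by auto
  ultimately show ?thesis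
    by (simp add: nonzero_eq_divide_eq algebra_simps)
qed

text \<open>Each of the \<open>n\<close> copies of \<open>y ^ n\<close> is at most
  \<open>y * y ^ i\<close> with \<open>i < n\<close>, and the factor \<open>1 - y\<close> collapses
  the resulting geometric sum.\<close>

lemma of_nat_times_power_le:
  fixes y :: real
  assumes "0 \<le> y" "y \<le> 1"
  shows "real n * y ^ n * (1 - y) \<le> y"
proof -
  have "real n * y ^ n = (\<Sum>i<n. y ^ n)"
    by simp
  also have "\<dots> \<le> (\<Sum>i<n. y * y ^ i)"
    by (rule sum_mono) (use assms in \<open>auto simp flip: power_Suc intro!: power_decreasing\<close>)
  finally have "real n * y ^ n * (1 - y) \<le> (y * (\<Sum>i<n. y ^ i)) * (1 - y)"
    unfolding sum_distrib_left using assms by (intro mult_right_mono) auto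
  also have "\<dots> = y * ((1 - y) * (\<Sum>i<n. y ^ i))"
    by (simp only: mult_ac)
  also have "\<dots> = y * (1 - y ^ n)"
    by (simp flip: one_diff_power_eq)
  also have "\<dots> \<le> y"
    using assms by (simp add: mult_left_le)
  finally show ?thesis .
qed

text \<open>In the closed form, the factor \<open>1 - y\<close> of \<open>1 - y\<^sup>2\<close>
  absorbs the growing coefficient \<open>2*M+1\<close>, so the numerator is at most
  \<open>4 * y\<close> in absolute value.\<close>

lemma alternating_mean_bound:
  assumes "0 \<le> y" "y \<le> 1"
  shows "\<bar>alternating_mean M y\<bar> \<le> 3 * y"
proof -
  let ?a = "real (2*M+1) * y ^ (2*M+1) * (1 - y)"
  have a: "0 \<le> ?a" "?a \<le> y"
    using assms of_nat_times_power_le[OF assms, of "2*M+1"] by auto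
  then have b: "0 \<le> ?a * (1 + y)" "?a * (1 + y) \<le> y * 2"
    using assms by (auto intro!: mult_mono simp del: of_nat_add)
  have c: "0 \<le> y ^ (2*M+2)" "y ^ (2*M+2) \<le> y"
    using assms power_decreasing[of 1 "2*M+2" y] by auto
  have d: "real (2*M+1) * y ^ (2*M+1) * (1 - y\<^sup>2) = ?a * (1 + y)"
    by (simp add: power2_eq_square algebra_simps)
  have e: "1 \<le> (1 + y)\<^sup>2"
    using assms by (simp add: one_le_power)
  have "\<bar>2 * y - ?a * (1 + y) + 2 * y ^ (2*M+2)\<bar> \<le> 4 * y"
    using b c assms(1) by linarith
  then have "\<bar>alternating_mean M y\<bar> \<le> 4 * y / \<bar>2 * (1 + y)\<^sup>2\<bar>"
    unfolding alternating_mean_closed_form[OF assms(1)] abs_divide d by (rule divide_right_mono) simp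
  also have "\<dots> = 4 * y / (2 * (1 + y)\<^sup>2)"
    by simp
  also have "\<dots> \<le> 4 * y / 2"
    using e assms by (intro divide_left_mono) auto
  finally show ?thesis
    using assms by simp
qed

lemma alternating_mean_tendsto:
  assumes "0 \<le> y" "y < 1"
  shows "(\<lambda>M. alternating_mean M y) \<longlonglongrightarrow> y / (1 + y)\<^sup>2"
proof -
  have sm: "strict_mono (\<lambda>M::nat. 2*M+1)" "strict_mono (\<lambda>M::nat. 2*M+2)"
    by (auto simp: strict_mono_def)
  have 1: "(\<lambda>M. real (2*M+1) * y ^ (2*M+1)) \<longlonglongrightarrow> 0"
    using LIMSEQ_subseq_LIMSEQ[OF powser_times_n_limit_0[of y] sm(1)] assms by (simp add: o_def)
  have 2: "(\<lambda>M. y ^ (2*M+2)) \<longlonglongrightarrow> 0"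
    using LIMSEQ_subseq_LIMSEQ[OF LIMSEQ_realpow_zero[of y] sm(2)] assms by (simp add: o_def)
  have "(\<lambda>M. (2 * y - real (2*M+1) * y ^ (2*M+1) * (1 - y\<^sup>2) + 2 * y ^ (2*M+2))
    / (2 * (1 + y)\<^sup>2)) \<longlonglongrightarrow> (2 * y - 0 * (1 - y\<^sup>2) + 2 * 0) / (2 * (1 + y)\<^sup>2)"
    using assms by (intro tendsto_intros 1 2) auto
  then show ?thesis
    using assms by (simp add: alternating_mean_closed_form)
qed

section \<open>Wallis' product and passage to the limit\<close>

text \<open>The weights 1, -2, 1 cancel \<open>euler_mascheroni\<close> in every summand and combine
  the logarithms into that of a Wallis factor; only the leading \<open>y\<close> contributes
  \<open>- euler_mascheroni\<close>.\<close>

lemma ln_times_alternating_mean_has_integral: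
  "((\<lambda>t::real. ln t * alternating_mean M (exp (- t))) has_integral
     (- euler_mascheroni + ln (\<Prod>k=1..M. (4*real k^2) / (4*real k^2 - 1))) / 2) {0<..}"
proof -
  note I = ln_times_exp_minus_power_has_integral
  let ?W = "\<lambda>m. (- euler_mascheroni - ln (real (2*m-1))) - 2 * (- euler_mascheroni - ln (real (2*m)))
    + (- euler_mascheroni - ln (real (2*m+1))) :: real"
  \<comment> \<open>The leading \<open>y\<close> is written as the term \<open>n = 1\<close>, so the
    same power integral covers it, with \<open>ln 1 = 0\<close>.\<close>
  have "((\<lambda>t. (ln t * (real 1 * exp (- t) ^ 1) + (\<Sum>m=1..M. ln t * (real (2*m-1) * exp (- t) ^ (2*m-1))
      - 2 * (ln t * (real (2*m) * exp (- t) ^ (2*m)))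
      + ln t * (real (2*m+1) * exp (- t) ^ (2*m+1)))) / 2)
    has_integral ((- euler_mascheroni - ln (real 1)) + (\<Sum>m=1..M. ?W m)) / 2) {0<..}"
    by (intro has_integral_divide has_integral_add has_integral_sum has_integral_diff
        has_integral_mult_right I) auto
  moreover have "(\<Sum>m=1..M. ?W m) = ln (\<Prod>k=1..M. (4*real k^2) / (4*real k^2 - 1))"
  proof -
    have pos: "0 < 4 * (real m)\<^sup>2 / (4 * (real m)\<^sup>2 - 1)"
      and W: "?W m = ln (4 * (real m)\<^sup>2 / (4 * (real m)\<^sup>2 - 1))" if "m \<in> {1..M}" for m
    proof -
      have m: "0 < real m" "0 < 2 * real m - 1" "0 < 2 * real m + 1" "real (2*m-1) = 2 * real m - 1"
        using that by auto
      have eq: "4 * (real m)\<^sup>2 / (4 * (real m)\<^sup>2 - 1)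
          = (2 * real m)^2 / ((2 * real m - 1) * (2 * real m + 1))"
        by (simp add: power2_eq_square algebra_simps)
      show "0 < 4 * (real m)\<^sup>2 / (4 * (real m)\<^sup>2 - 1)"
        unfolding eq using m by (intro divide_pos_pos mult_pos_pos zero_less_power) auto
      show "?W m = ln (4 * (real m)\<^sup>2 / (4 * (real m)\<^sup>2 - 1))"
      proof -
        have "ln ((2 * real m)\<^sup>2) = 2 * ln (real (2*m))"
          using m by (subst ln_realpow) auto
        moreover have "ln ((2 * real m - 1) * (2 * real m + 1)) = ln (real (2*m-1)) + ln (real (2*m+1))"
          unfolding m(4) using m by (subst ln_mult_pos) auto
        ultimately show ?thesis
          unfolding eq using m by (subst ln_div) auto
      qed
    qed
    have "(\<Sum>m=1..M. ?W m) = (\<Sum>m=1..M. ln (4 * (real m)\<^sup>2 / (4 * (real m)\<^sup>2 - 1)))"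
      by (rule sum.cong[OF refl W])
    also have "\<dots> = ln (\<Prod>k=1..M. (4*real k^2) / (4*real k^2 - 1))"
      by (intro ln_prod[symmetric] finite_atLeastAtMost less_imp_neq[symmetric] pos)
    finally show ?thesis .
  qed
  ultimately show ?thesis
    by (simp add: alternating_mean_def sum_distrib_left algebra_simps)
qed

text \<open>The uniform bound on the means supplies the majorant
  \<open>3 * \<bar>ln t * exp (- t)\<bar>\<close>, which also dominates \<open>f\<close>. Absolute
  integrability is recorded for the later change of variables.\<close>

lemma ln_times_exp_over_one_plus_exp_sq:
  fixes f :: "real \<Rightarrow> real"
  defines "f \<equiv> \<lambda>t. ln t * (exp (- t) / (1 + exp (- t))\<^sup>2)"
  shows "f absolutely_integrable_on {0<..}"
    and "(f has_integral (ln (pi / 2) - euler_mascheroni) / 2) {0<..}"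
proof -
  define g :: "real \<Rightarrow> real" where "g = (\<lambda>t. 3 * \<bar>ln t * exp (- t)\<bar>)"
  have g: "g integrable_on {0<..}"
    unfolding g_def using ln_times_exp_minus_absolutely_integrable
    by (simp add: absolutely_integrable_on_def)
  show int: "(f has_integral (ln (pi / 2) - euler_mascheroni) / 2) {0<..}"
  proof (rule has_integral_dominated_convergence[OF ln_times_alternating_mean_has_integral g])
    show "\<forall>t\<in>{0<..}. norm (ln t * alternating_mean M (exp (- t))) \<le> g t" for M
    proof
      fix t :: real
      assume "t \<in> {0<..}"
      then have "\<bar>ln t\<bar> * \<bar>alternating_mean M (exp (- t))\<bar> \<le> \<bar>ln t\<bar> * (3 * exp (- t))"
        by (intro mult_left_mono alternating_mean_bound) auto
      then show "norm (ln t * alternating_mean M (exp (- t))) \<le> g t"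
        by (simp add: g_def abs_mult)
    qed
    show "\<forall>t\<in>{0<..}. (\<lambda>M. ln t * alternating_mean M (exp (- t))) \<longlonglongrightarrow> f t"
      unfolding f_def by (intro ballI tendsto_mult_left alternating_mean_tendsto) auto
    have "(\<lambda>M. (- euler_mascheroni + ln (\<Prod>k=1..M. (4*real k^2) / (4*real k^2 - 1))) / 2)
        \<longlonglongrightarrow> (- euler_mascheroni + ln (pi / 2)) / 2"
      by (intro tendsto_intros wallis) auto
    then show "(\<lambda>M. (- euler_mascheroni + ln (\<Prod>k=1..M. (4*real k^2) / (4*real k^2 - 1))) / 2)
        \<longlonglongrightarrow> (ln (pi / 2) - euler_mascheroni) / 2"
      by simp
  qed
  show "f absolutely_integrable_on {0<..}"
  proof (rule absolutely_integrable_integrable_bound[OF _ _ g])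
    show "f integrable_on {0<..}"
      using int by blast
    show "norm (f t) \<le> g t" if "t \<in> {0<..}" for t
    proof -
      have "1 \<le> (1 + exp (- t))\<^sup>2"
        by (simp add: one_le_power)
      then have "exp (- t) / (1 + exp (- t))\<^sup>2 \<le> exp (- t) / 1"
        by (intro frac_le) auto
      also have "\<dots> \<le> 3 * exp (- t)"
        by simp
      finally have "\<bar>ln t\<bar> * (exp (- t) / (1 + exp (- t))\<^sup>2) \<le> \<bar>ln t\<bar> * (3 * exp (- t))"
        by (rule mult_left_mono) simp
      then show ?thesis
        by (simp add: f_def g_def abs_mult)
    qed
  qed
qed

section \<open>Substitution back to the unit interval\<close>

theorem corollary3p1:
  "((\<lambda>x::real. ln (- ln x) * (1 / (1 + x)\<^sup>2)) has_integral
     (1 / 2 * (ln (pi / 2) - euler_mascheroni))) {0<..<1}"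
proof -
  let ?F = "\<lambda>x::real. ln (- ln x) * (1 / (1 + x)\<^sup>2)"
  have img: "(\<lambda>t::real. exp (- t)) ` {0<..} = {0<..<1}"
  proof (intro equalityI subsetI)
    fix x :: real
    assume "x \<in> {0<..<1}"
    then show "x \<in> (\<lambda>t::real. exp (- t)) ` {0<..}"
      by (intro image_eqI[of _ _ "- ln x"]) auto
  qed auto
  \<comment> \<open>The Jacobian \<open>exp (- t)\<close> supplies the numerator of
    \<open>y / (1 + y)\<^sup>2\<close>.\<close>
  have eq: "(\<lambda>t. \<bar>- exp (- t)\<bar> * ?F (exp (- t))) = (\<lambda>t. ln t * (exp (- t) / (1 + exp (- t))\<^sup>2))"
    by auto
  have "?F absolutely_integrable_on (\<lambda>t::real. exp (- t)) ` {0<..} \<and>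
      integral ((\<lambda>t::real. exp (- t)) ` {0<..}) ?F = (ln (pi / 2) - euler_mascheroni) / 2"
  \<comment> \<open>The change of variables is an equivalence, so integrability and value carry over
    together from the half-line.\<close>
  proof (rule iffD1[OF has_absolute_integral_change_of_variables_1'[where g' = "\<lambda>t. - exp (- t)"]])
    show "(\<lambda>t. \<bar>- exp (- t)\<bar> * ?F (exp (- t))) absolutely_integrable_on {0<..} \<and>
      integral {0<..} (\<lambda>t. \<bar>- exp (- t)\<bar> * ?F (exp (- t))) = (ln (pi / 2) - euler_mascheroni) / 2"
      unfolding eq using ln_times_exp_over_one_plus_exp_sq(1)
        integral_unique[OF ln_times_exp_over_one_plus_exp_sq(2)] by (rule conjI)
  qed (auto intro!: derivative_eq_intros simp: inj_on_def)
  then show ?thesis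
    unfolding img by (simp add: has_integral_iff set_lebesgue_integral_eq_integral(1))
qed

end
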